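(* Let a leaf node $v$ have $n$ samples, of which $n^{+}$ are positive and $n^{-}=n-n^{+}$ negative in the noise-free data, and let $\rho=(n^{+}-n^{-})/n\neq 0$ be the difference between the fractions of positive and negative samples in the noise-free case. Let the labels be corrupted by symmetric label noise with rate $\eta\in[0,0.5)$, and let $\delta\in(0,1)$. If $$n\ \ge\ \frac{2}{\rho^{2}(1-2\eta)^{2}}\ln\Bigl(\frac1\delta\Bigr),$$ then with probability at least $1-\delta$ majority voting at $v$ on the noisy labels does not fail.
   Context: Symmetric label noise with rate $\eta$: each of the $n$ labels is flipped (from $+1$ to $-1$ or from $-1$ to $+1$) independently with probability $\eta$. Let $\tilde n^{+}$ and $\tilde n^{-}=n-\tilde n^{+}$ be the numbers of samples at $v$ with noisy label $+1$ and $-1$. Majority voting assigns to the leaf the class with more samples. It is said to fail if the noise-free majority class becomes a strict minority under the noisy labels, i.e. if $\tilde n^{+}-\tilde n^{-}<0$ when $n^{+}>n^{-}$, or $\tilde n^{-}-\tilde n^{+}<0$ when $n^{-}>n^{+}$. *)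

theory Defs
  imports "HOL-Probability.Probability"
begin

text \<open>
  Labels are the integers \<open>1\<close> and \<open>-1\<close>; the samples at the leaf form a finite set \<open>S\<close>.
\<close>

definition label_count :: "'s set \<Rightarrow> ('s \<Rightarrow> int) \<Rightarrow> int \<Rightarrow> nat" where
  "label_count S y c = card {i \<in> S. y i = c}"

text \<open>
  \<open>F i \<omega>\<close> means that the label of sample \<open>i\<close> is flipped in outcome \<open>\<omega>\<close>. The notion
  \<open>indep_vars\<close> includes measurability of each \<open>F i\<close>.
\<close>

definition symmetric_label_noise ::
    "'w measure \<Rightarrow> 's set \<Rightarrow> real \<Rightarrow> ('s \<Rightarrow> 'w \<Rightarrow> bool) \<Rightarrow> bool" where
  "symmetric_label_noise M S \<eta> F \<longleftrightarrow>
     prob_space M \<and>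
     prob_space.indep_vars M (\<lambda>_. count_space UNIV) F S \<and>
     (\<forall>i\<in>S. measure M {\<omega> \<in> space M. F i \<omega>} = \<eta>)"

definition noisy_label :: "('s \<Rightarrow> int) \<Rightarrow> ('s \<Rightarrow> 'w \<Rightarrow> bool) \<Rightarrow> 'w \<Rightarrow> 's \<Rightarrow> int" where
  "noisy_label y F \<omega> i = (if F i \<omega> then - y i else y i)"

text \<open>
  Failure of majority voting with noise-free labels \<open>y\<close> and noisy labels \<open>y'\<close>: the noise-free
  majority class is a strict minority under \<open>y'\<close>, so a tie under \<open>y'\<close> is not a failure.
\<close>

definition majority_voting_fails :: "'s set \<Rightarrow> ('s \<Rightarrow> int) \<Rightarrow> ('s \<Rightarrow> int) \<Rightarrow> bool" where
  "majority_voting_fails S y y' \<longleftrightarrow>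
     (label_count S y 1 > label_count S y (-1) \<and>
        int (label_count S y' 1) - int (label_count S y' (-1)) < 0) \<or>
     (label_count S y (-1) > label_count S y 1 \<and>
        int (label_count S y' (-1)) - int (label_count S y' 1) < 0)"

end

theory Submission imports Defs begin

text \<open>
  The noise-free margin \<open>D = n\<^sup>+ - n\<^sup>-\<close> is the sum of the labels, and voting fails iff the noisy
  sum has the strictly opposite sign to \<open>D\<close>. Each noisy label has mean \<open>(1 - 2\<eta>) y\<^sub>i\<close>, so \<open>D\<close> times
  the noisy sum has mean \<open>D\<^sup>2 (1 - 2\<eta>)\<close>, and Hoeffding's inequality bounds the probability that it
  is nonpositive by \<open>exp (-D\<^sup>2 (1 - 2\<eta>)\<^sup>2 / (2n))\<close>.
\<close>

lemma label_count_diff_eq_sum: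
  assumes "finite S" and "\<And>i. i \<in> S \<Longrightarrow> y i \<in> {1, -1}"
  shows "int (label_count S y 1) - int (label_count S y (-1)) = (\<Sum>i\<in>S. y i)"
proof -
  \<comment> \<open>A label in {1, -1} is the indicator of being 1 minus the indicator of being -1;
    summing the two indicators gives the two counts.\<close>
  have "(\<Sum>i\<in>S. y i) = (\<Sum>i\<in>S. (if y i = 1 then 1 else 0) - (if y i = -1 then 1 else 0))"
    using assms(2) by (intro sum.cong) auto
  also have "\<dots> = int (label_count S y 1) - int (label_count S y (-1))"
    using assms(1)
    by (simp add: sum_subtractf label_count_def sum.If_cases Int_def)
  finally show ?thesis by simp
qed

lemma noisy_label_in:
  "y i \<in> {1, -1} \<Longrightarrow> noisy_label y F \<omega> i \<in> {1, -1}"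
  by (auto simp: noisy_label_def)

text \<open>The sign of the product merges the two symmetric cases of the definition. Strictness
  matches the convention on ties: a zero noisy sum is no failure.\<close>

lemma majority_voting_fails_iff:
  assumes "finite S"
    and "\<And>i. i \<in> S \<Longrightarrow> y i \<in> {1, -1}" and "\<And>i. i \<in> S \<Longrightarrow> y' i \<in> {1, -1}"
  shows "majority_voting_fails S y y' \<longleftrightarrow> (\<Sum>i\<in>S. y i) * (\<Sum>i\<in>S. y' i) < 0"
  using label_count_diff_eq_sum[of S y] label_count_diff_eq_sum[of S y'] assms
  unfolding majority_voting_fails_def mult_less_0_iff by force

text \<open>A flip lowers the label from \<open>y i\<close> to \<open>- y i\<close>, so the noisy
  label is \<open>y i\<close> minus \<open>2 * y i\<close> times the indicator of the flip
  event.\<close>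

lemma (in prob_space) expectation_noisy_label:
  assumes [measurable]: "F i \<in> measurable M (count_space UNIV)"
    and "prob {\<omega> \<in> space M. F i \<omega>} = \<eta>"
  shows "expectation (\<lambda>\<omega>. real_of_int (noisy_label y F \<omega> i)) = (1 - 2 * \<eta>) * y i"
proof -
  let ?A = "{\<omega> \<in> space M. F i \<omega>}"
  have "expectation (\<lambda>\<omega>. real_of_int (noisy_label y F \<omega> i)) =
      expectation (\<lambda>\<omega>. real_of_int (y i) - 2 * real_of_int (y i) * indicator ?A \<omega>)"
    by (intro Bochner_Integration.integral_cong) (auto simp: noisy_label_def)
  also have "\<dots> = y i - 2 * y i * prob ?A"
    by (subst Bochner_Integration.integral_diff)
      (auto simp: prob_space emeasure_eq_measure intro!: integrable_mult_right integrable_real_indicator)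
  finally show ?thesis
    using assms(2) by (simp add: algebra_simps)
qed

text \<open>Measurability is proved along with the bound because the theorem passes to the
  complementary event.\<close>

lemma majority_voting_fails_prob_le:
  fixes y :: "'s \<Rightarrow> int" and \<eta> :: real
  assumes "finite S" and y: "\<And>i. i \<in> S \<Longrightarrow> y i \<in> {1, -1}"
    and "(\<Sum>i\<in>S. y i) \<noteq> 0" and "\<eta> \<le> 1 / 2"
    and noise: "symmetric_label_noise M S \<eta> F"
  defines "D \<equiv> real_of_int (\<Sum>i\<in>S. y i)"
  shows "{\<omega> \<in> space M. majority_voting_fails S y (noisy_label y F \<omega>)} \<in> sets M"
    and "measure M {\<omega> \<in> space M. majority_voting_fails S y (noisy_label y F \<omega>)}
      \<le> exp (- (D\<^sup>2 * (1 - 2 * \<eta>)\<^sup>2 / (2 * card S)))"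
proof -
  interpret prob_space M
    using noise by (simp add: symmetric_label_noise_def)
  have indep: "indep_vars (\<lambda>_. count_space UNIV) F S"
    and flip_prob: "\<And>i. i \<in> S \<Longrightarrow> prob {\<omega> \<in> space M. F i \<omega>} = \<eta>"
    using noise by (auto simp: symmetric_label_noise_def)
  have F: "F i \<in> measurable M (count_space UNIV)" if "i \<in> S" for i
    using indep that by (auto simp: indep_vars_def)
  \<comment> \<open>The factor \<open>D\<close> orients every summand towards the noise-free
    majority, so a single lower-tail bound serves both signs of \<open>D\<close>.\<close>
  define X where "X i \<omega> = D * real_of_int (noisy_label y F \<omega> i)" for i \<omega>
  have "D \<noteq> 0" using assms(3) unfolding D_def by linarith
  have "S \<noteq> {}" using assms(3) by auto
  have X_bound: "X i \<omega> \<in> {- \<bar>D\<bar>..\<bar>D\<bar>}" if "i \<in> S" for i \<omega>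
    using noisy_label_in[of y i F \<omega>] y[OF that] by (auto simp: X_def)
  have "(\<Sum>i\<in>S. expectation (X i)) = (\<Sum>i\<in>S. D * ((1 - 2 * \<eta>) * y i))"
    by (intro sum.cong) (auto simp: X_def[abs_def] expectation_noisy_label[OF F flip_prob])
  \<comment> \<open>Pulling out \<open>D * (1 - 2 * \<eta>)\<close> leaves the sum of the labels,
    which is \<open>D\<close> again.\<close>
  then have mean: "(\<Sum>i\<in>S. expectation (X i)) = D\<^sup>2 * (1 - 2 * \<eta>)"
    by (simp add: D_def power2_eq_square flip: sum_distrib_left)
  \<comment> \<open>Each \<open>X i\<close> is a deterministic function of the flip of sample
    \<open>i\<close> alone, so independence carries over.\<close>
  have "indep_vars (\<lambda>_. borel) X S"
    unfolding X_def noisy_label_def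
    using indep_vars_compose2[OF indep,
        of "\<lambda>i b. D * real_of_int (if b then - y i else y i)" "\<lambda>_. borel"] by simp
  then interpret Hoeffding_ineq M S X "\<lambda>_. - \<bar>D\<bar>" "\<lambda>_. \<bar>D\<bar>" "D\<^sup>2 * (1 - 2 * \<eta>)"
    using X_bound \<open>finite S\<close> by unfold_locales (auto simp: mean)
  have fails_iff: "majority_voting_fails S y (noisy_label y F \<omega>) \<longleftrightarrow> (\<Sum>i\<in>S. X i \<omega>) < 0" for \<omega>
  proof -
    have "(\<Sum>i\<in>S. X i \<omega>) = of_int ((\<Sum>i\<in>S. y i) * (\<Sum>i\<in>S. noisy_label y F \<omega> i))"
      by (simp add: X_def D_def flip: sum_distrib_left)
    then show ?thesis
      using majority_voting_fails_iff[of S y "noisy_label y F \<omega>"] \<open>finite S\<close> y noisy_label_in[of y]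
      by (metis of_int_less_0_iff)
  qed
  show "{\<omega> \<in> space M. majority_voting_fails S y (noisy_label y F \<omega>)} \<in> sets M"
    unfolding fails_iff by measurable
  \<comment> \<open>The deviation is chosen equal to the whole mean, so the threshold is 0; it is
    nonnegative because \<eta> \<le> 1/2. Relaxing < to \<le> puts ties into the bounded
    event.\<close>
  have "prob {\<omega> \<in> space M. majority_voting_fails S y (noisy_label y F \<omega>)}
      \<le> prob {\<omega> \<in> space M. (\<Sum>i\<in>S. X i \<omega>) \<le> D\<^sup>2 * (1 - 2 * \<eta>) - D\<^sup>2 * (1 - 2 * \<eta>)}"
    unfolding fails_iff by (intro finite_measure_mono) auto
  also have "\<dots> \<le> exp (- 2 * (D\<^sup>2 * (1 - 2 * \<eta>))\<^sup>2 / (\<Sum>i\<in>S. (\<bar>D\<bar> - - \<bar>D\<bar>)\<^sup>2))"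
    using \<open>\<eta> \<le> 1 / 2\<close> \<open>D \<noteq> 0\<close> \<open>S \<noteq> {}\<close> \<open>finite S\<close>
    by (intro Hoeffding_ineq_le) (auto simp: card_gt_0_iff)
  \<comment> \<open>Every range has length \<open>2 * \<bar>D\<bar>\<close>, so the denominator is 4
    |S| \<open>D\<^sup>2\<close> and cancels two of the four powers of \<open>D\<close>
    above.\<close>
  also have "- 2 * (D\<^sup>2 * (1 - 2 * \<eta>))\<^sup>2 / (\<Sum>i\<in>S. (\<bar>D\<bar> - - \<bar>D\<bar>)\<^sup>2)
      = - (D\<^sup>2 * (1 - 2 * \<eta>)\<^sup>2 / (2 * card S))"
    using \<open>D \<noteq> 0\<close> \<open>S \<noteq> {}\<close> \<open>finite S\<close>
    by (simp add: power_mult_distrib power2_eq_square divide_simps card_eq_0_iff)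
  finally show "prob {\<omega> \<in> space M. majority_voting_fails S y (noisy_label y F \<omega>)}
      \<le> exp (- (D\<^sup>2 * (1 - 2 * \<eta>)\<^sup>2 / (2 * card S)))" .
qed

theorem lemma7:
  fixes M :: "'w measure" and S :: "'s set" and y :: "'s \<Rightarrow> int"
    and F :: "'s \<Rightarrow> 'w \<Rightarrow> bool" and n n_pos n_neg :: nat and \<rho> \<eta> \<delta> :: real
  assumes "finite S"
    and "\<And>i. i \<in> S \<Longrightarrow> y i \<in> {1, -1}"
    and "n = card S"
    and "n_pos = label_count S y 1"
    and "n_neg = label_count S y (-1)"
    and "\<rho> = (real n_pos - real n_neg) / real n"
    and "\<rho> \<noteq> 0"
    and "0 \<le> \<eta>" and "\<eta> < 0.5"
    and "symmetric_label_noise M S \<eta> F"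
    and "0 < \<delta>" and "\<delta> < 1"
    and "real n \<ge> 2 / (\<rho>^2 * (1 - 2 * \<eta>)^2) * ln (1 / \<delta>)"
  shows "measure M {\<omega> \<in> space M. \<not> majority_voting_fails S y (noisy_label y F \<omega>)} \<ge> 1 - \<delta>"
proof -
  interpret prob_space M
    using assms(10) by (simp add: symmetric_label_noise_def)
  let ?fails = "{\<omega> \<in> space M. majority_voting_fails S y (noisy_label y F \<omega>)}"
  define D where "D = real_of_int (\<Sum>i\<in>S. y i)"
  have "D = real n_pos - real n_neg"
    using arg_cong[where f = real_of_int, OF label_count_diff_eq_sum[OF assms(1,2)]]
    unfolding D_def assms(4,5) by simp
  then have \<rho>: "\<rho> = D / n" using assms(6) by simp
  \<comment> \<open>If \<open>n\<close> were 0, division by zero would give \<rho> = 0.\<close>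
  then have "D \<noteq> 0" and "n > 0" using \<open>\<rho> \<noteq> 0\<close> by (auto intro: Nat.gr0I)
  \<comment> \<open>Clearing the denominator of the sample size bound uses that \<rho> and 1 -
    2\<eta> are nonzero.\<close>
  have "ln (1 / \<delta>) \<le> \<rho>\<^sup>2 * (1 - 2 * \<eta>)\<^sup>2 * n / 2"
    using assms(13) \<open>\<rho> \<noteq> 0\<close> \<open>\<eta> < 0.5\<close> by (simp add: divide_simps mult_ac)
  also have "\<dots> = D\<^sup>2 * (1 - 2 * \<eta>)\<^sup>2 / (2 * n)"
    using \<open>n > 0\<close> unfolding \<rho> by (simp add: power_divide power2_eq_square)
  finally have "- (D\<^sup>2 * (1 - 2 * \<eta>)\<^sup>2 / (2 * n)) \<le> ln \<delta>"
    using \<open>0 < \<delta>\<close> by (simp add: ln_div)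
  then have "exp (- (D\<^sup>2 * (1 - 2 * \<eta>)\<^sup>2 / (2 * n))) \<le> \<delta>"
    using \<open>0 < \<delta>\<close> by (simp add: ln_ge_iff)
  moreover have "(\<Sum>i\<in>S. y i) \<noteq> 0" using \<open>D \<noteq> 0\<close> unfolding D_def by linarith
  moreover have "\<eta> \<le> 1 / 2" using assms(9) by simp
  ultimately have "?fails \<in> events" and "prob ?fails \<le> \<delta>"
    using majority_voting_fails_prob_le[where y = y, OF assms(1,2) _ _ assms(10)]
    unfolding D_def assms(3) by (blast, fastforce)
  then show ?thesis by (simp add: prob_neg)
qed

end
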